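(* Let $q$ be a prime power and $a,b,d,u$ integers with $2\le d\le\min\{a,b\}$ and $0\le u$. Then $\Lambda(q,a,b,d,u)\le\Lambda(q,a,b-1,d-1,u)$ and $$\Lambda(q,a,b,d,u)\le\sum_{r=0}^{\min\{u,\min\{a,b\}-d+1\}}q^{\binom r2}(q-1)^r[r]_q!\binom{\min\{a,b\}-d+1}{r}_q\binom{\max\{a,b\}}{r}_q.$$
   Context: $\Lambda(q,a,b,d,u)$ is the maximum size of a set of $a\times b$ matrices over $\mathbb{F}_q$ such that any two distinct elements $X,Y$ satisfy $\mathrm{rk}(X-Y)\ge d$ and every element has rank at most $u$. $[n]_q=(q^n-1)/(q-1)$, $[r]_q!=\prod_{i=1}^r[i]_q$ (with $[0]_q!=1$), and $\binom{n}{k}_q=\prod_{i=0}^{k-1}\frac{q^n-q^i}{q^k-q^i}$. *)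

theory Defs
  imports
    "HOL-Library.Cardinality"
    "HOL-Number_Theory.Prime_Powers"
    "Jordan_Normal_Form.DL_Rank"
begin

definition rank_codes :: "'f::{field,finite} itself \<Rightarrow> nat \<Rightarrow> nat \<Rightarrow> nat \<Rightarrow> nat \<Rightarrow> 'f mat set set"
  where "rank_codes F a b d u =
    {C. C \<subseteq> carrier_mat a b
      \<and> (\<forall>X\<in>C. \<forall>Y\<in>C. X \<noteq> Y \<longrightarrow> d \<le> vec_space.rank a (X - Y))
      \<and> (\<forall>X\<in>C. vec_space.rank a X \<le> u)}"

text \<open>The parameter \<open>q\<close> is carried by the finite field type \<open>'f\<close>, as \<open>q = CARD('f)\<close>.\<close>

definition Lambda :: "'f::{field,finite} itself \<Rightarrow> nat \<Rightarrow> nat \<Rightarrow> nat \<Rightarrow> nat \<Rightarrow> nat"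
  where "Lambda F a b d u = Max (card ` rank_codes F a b d u)"

definition q_int :: "nat \<Rightarrow> nat \<Rightarrow> real"
  where "q_int q n = (real q ^ n - 1) / (real q - 1)"

definition q_fact :: "nat \<Rightarrow> nat \<Rightarrow> real"
  where "q_fact q r = (\<Prod>i=1..r. q_int q i)"

definition q_binomial :: "nat \<Rightarrow> nat \<Rightarrow> nat \<Rightarrow> real"
  where "q_binomial q n k =
    (\<Prod>i<k. (real q ^ n - real q ^ i) / (real q ^ k - real q ^ i))"

text \<open>The maximum in \<^const>\<open>Lambda\<close> ranges over a finite nonempty set, so it is attained.\<close>

lemma finite_carrier_mat: "finite (carrier_mat a b :: 'f::finite mat set)"
proof (rule finite_subset)
  let ?I = "{..<a} \<times> {..<b}"
  show "carrier_mat a b \<subseteq> (\<lambda>f. mat a b f :: 'f mat) ` (?I \<rightarrow>\<^sub>E UNIV)"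
  proof
    fix A :: "'f mat" assume "A \<in> carrier_mat a b"
    then have "A = mat a b (restrict (\<lambda>p. A $$ p) ?I)" by (intro eq_matI) auto
    then show "A \<in> (\<lambda>f. mat a b f) ` (?I \<rightarrow>\<^sub>E UNIV)"
      by (rule image_eqI[where x = "restrict (\<lambda>p. A $$ p) ?I"]) simp
  qed
  show "finite ((\<lambda>f. mat a b f :: 'f mat) ` (?I \<rightarrow>\<^sub>E UNIV))"
    by (intro finite_imageI finite_PiE) auto
qed

lemma finite_rank_codes: "finite (rank_codes F a b d u)"
  by (rule finite_subset[of _ "Pow (carrier_mat a b)"])
    (auto simp: rank_codes_def finite_carrier_mat)

lemma Lambda_attained: "\<exists>C\<in>rank_codes F a b d u. card C = Lambda F a b d u"
proof -
  have "{} \<in> rank_codes F a b d u" by (simp add: rank_codes_def)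
  then have "Lambda F a b d u \<in> card ` rank_codes F a b d u"
    unfolding Lambda_def by (intro Max_in finite_imageI finite_rank_codes) auto
  then show ?thesis by auto
qed

lemma card_le_Lambda: "C \<in> rank_codes F a b d u \<Longrightarrow> card C \<le> Lambda F a b d u"
  unfolding Lambda_def by (intro Max_ge finite_imageI finite_rank_codes imageI)

end

theory Submission
  imports Defs "Berlekamp_Zassenhaus.Berlekamp_Type_Based"
begin

text \<open>Over the field with \<open>q\<close> elements the image of a matrix \<open>A\<close> has \<open>q ^ rank A\<close> elements, so
  ranks can be compared by counting. Deleting a column or a row changes the rank by at most one
  and never increases it; hence it maps a code of minimum distance \<open>d \<ge> 2\<close> injectively to one of
  minimum distance \<open>d - 1\<close> with the same bound on the ranks. Doing this \<open>d - 1\<close> times along the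
  shorter side leaves a set of matrices of rank at most \<open>u\<close>. The number of \<open>a \<times> n\<close> matrices
  of rank \<open>r\<close> is found by appending columns: \<open>A\<close> keeps its rank for the \<open>q ^ rank A\<close> columns in
  its image and gains one otherwise, a recursion that matches the \<open>q\<close>-Pascal rule.\<close>

section \<open>Rank as the logarithm of the size of the image\<close>

text \<open>Kept outside the locale \<open>vec_space\<close>, which fixes the number of rows, so
  that images in spaces of different dimensions can be compared.\<close>

definition mat_range :: "'a::semiring_0 mat \<Rightarrow> 'a vec set" where
  "mat_range A = (\<lambda>x. A *\<^sub>v x) ` carrier_vec (dim_col A)"

lemma (in vec_space) mat_range_eq_span:
  assumes "A \<in> carrier_mat n nc"
  shows "mat_range A = span (set (cols A))"
  using col_space_eq[OF assms] assms unfolding col_space_def mat_range_def by auto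

text \<open>A vector of \<open>S\<close> outside \<open>span U\<close> could be adjoined to
  \<open>U\<close> without losing independence, against maximality.\<close>

lemma (in vec_space) maximal_indep_span:
  assumes S: "S \<subseteq> carrier_vec n" and U: "maximal U (\<lambda>T. T \<subseteq> S \<and> lin_indpt T)"
  shows "span U = span S"
proof
  have US: "U \<subseteq> S" and li: "lin_indpt U" using U by (auto simp: maximal_def)
  show "span U \<subseteq> span S" by (rule span_is_monotone[OF US])
  have "s \<in> span U" if s: "s \<in> S" for s
  proof (rule ccontr)
    assume ns: "s \<notin> span U"
    have "s \<notin> U" using ns US S span_mem[of U s] by auto
    then have "lin_indpt (U \<union> {s})"
      using lin_dep_iff_in_span[of U s] US S s li ns by auto
    then show False using U s US \<open>s \<notin> U\<close> unfolding maximal_def by blast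
  qed
  then show "span S \<subseteq> span U"
    using US S by (intro span_subsetI) auto
qed

text \<open>A maximal independent set of columns forms a matrix with the same image that acts
  injectively, so the image is in bijection with the coefficient vectors of length
  \<open>rank A\<close>.\<close>

lemma card_mat_range:
  fixes A :: "'f::{field,finite} mat"
  assumes A: "A \<in> carrier_mat a n"
  shows "card (mat_range A) = CARD('f) ^ vec_space.rank a A"
proof -
  interpret vec_space "TYPE('f)" a .
  have S: "set (cols A) \<subseteq> carrier_vec a" using A cols_dim by blast
  obtain U where U: "maximal U (\<lambda>T. T \<subseteq> set (cols A) \<and> lin_indpt T)"
    using maximal_exists_superset[of "set (cols A)" "\<lambda>T. T \<subseteq> set (cols A) \<and> lin_indpt T" "{}"]
    by (auto simp: finite_lin_indpt2)
  then have US: "U \<subseteq> set (cols A)" and li: "lin_indpt U" by (auto simp: maximal_def)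
  obtain us where us: "set us = U" "distinct us"
    using US finite_distinct_list[of U] finite_subset by blast
  let ?B = "mat_of_cols a us"
  have usc: "set us \<subseteq> carrier_vec a" using us US S by auto
  have B: "?B \<in> carrier_mat a (length us)" and cB: "cols ?B = us"
    using cols_mat_of_cols[OF usc] by auto
  have eq: "mat_range A = mat_range ?B"
    unfolding mat_range_eq_span[OF A] mat_range_eq_span[OF B] cB us
    using maximal_indep_span[OF S U] by simp
  have inj: "inj_on (\<lambda>x. ?B *\<^sub>v x) (carrier_vec (length us))"
  proof (rule inj_onI)
    fix x y :: "'f vec" assume x: "x \<in> carrier_vec (length us)" and y: "y \<in> carrier_vec (length us)"
      and e: "?B *\<^sub>v x = ?B *\<^sub>v y"
    have "?B *\<^sub>v (x - y) = 0\<^sub>v a"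
      using mult_minus_distrib_mat_vec[OF B x y] e B y by auto
    \<comment> \<open>A nonzero kernel vector would be a linear dependence among the columns
      \<open>us\<close>; as these are distinct, it would be one of the set \<open>U\<close>.\<close>
    then have "x - y = 0\<^sub>v (length us)"
      using lin_depI[OF B, of "x - y"] x y cB us li by auto
    then show "x = y" using x y
      by (intro eq_vecI) (auto simp: vec_eq_iff)
  qed
  have "rank A = length us"
    using rank_card_indpt[OF A U] us distinct_card by fastforce
  then show ?thesis
    unfolding eq using B by (simp add: mat_range_def card_image[OF inj] card_carrier_vec)
qed

lemma CARD_field_ge_2: "2 \<le> CARD('f::{field,finite})"
  using card_mono[of "UNIV :: 'f set" "{0, 1}"] by simp

lemma finite_mat_range: "finite (mat_range (A :: 'f::{field,finite} mat))"
  by (simp add: mat_range_def)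

text \<open>Both sizes are powers of q \<ge> 2, so the exponents compare. The row counts may differ,
  as row deletion requires.\<close>

lemma rank_le_of_card_mat_range:
  fixes A B :: "'f::{field,finite} mat"
  assumes "A \<in> carrier_mat a n" "B \<in> carrier_mat b m"
    and "card (mat_range A) \<le> CARD('f) ^ k * card (mat_range B)"
  shows "vec_space.rank a A \<le> vec_space.rank b B + k"
proof -
  have "CARD('f) ^ vec_space.rank a A \<le> CARD('f) ^ (vec_space.rank b B + k)"
    using assms by (simp add: card_mat_range power_add mult.commute)
  then show ?thesis
    using CARD_field_ge_2[where 'f = 'f] by (simp add: power_increasing_iff)
qed

lemma rank_zero_mat: "vec_space.rank a (0\<^sub>m a n :: 'f::{field,finite} mat) = 0"
proof -
  have "mat_range (0\<^sub>m a n :: 'f mat) \<subseteq> {0\<^sub>v a}" by (auto simp: mat_range_def)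
  then have "card (mat_range (0\<^sub>m a n :: 'f mat)) \<le> 1"
    using card_mono[of "{0\<^sub>v a :: 'f vec}"] by fastforce
  then have "CARD('f) ^ vec_space.rank a (0\<^sub>m a n :: 'f mat) \<le> CARD('f) ^ 0"
    by (simp add: card_mat_range[of "0\<^sub>m a n :: 'f mat" a n])
  then show ?thesis using CARD_field_ge_2[where 'f = 'f]
    by (subst (asm) power_increasing_iff) auto
qed

section \<open>Appending and deleting columns and rows\<close>

definition add_col :: "'a mat \<Rightarrow> 'a vec \<Rightarrow> 'a mat" where
  "add_col A v = mat (dim_row A) (Suc (dim_col A))
     (\<lambda>(i, j). if j < dim_col A then A $$ (i, j) else v $ i)"

definition del_col :: "'a mat \<Rightarrow> 'a mat" where
  "del_col A = mat (dim_row A) (dim_col A - 1) (\<lambda>ij. A $$ ij)"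

definition del_row :: "'a mat \<Rightarrow> 'a mat" where
  "del_row A = mat (dim_row A - 1) (dim_col A) (\<lambda>ij. A $$ ij)"

lemma add_col_carrier: "A \<in> carrier_mat a n \<Longrightarrow> add_col A v \<in> carrier_mat a (Suc n)"
  by (auto simp: add_col_def)

lemma del_col_carrier: "A \<in> carrier_mat a (Suc n) \<Longrightarrow> del_col A \<in> carrier_mat a n"
  by (auto simp: del_col_def)

lemma del_row_carrier: "A \<in> carrier_mat (Suc a) n \<Longrightarrow> del_row A \<in> carrier_mat a n"
  by (auto simp: del_row_def)

lemma add_col_del_col:
  assumes "A \<in> carrier_mat a (Suc n)"
  shows "add_col (del_col A) (col A n) = A"
  using assms by (intro eq_matI) (auto simp: add_col_def del_col_def less_Suc_eq)

text \<open>Turns counting matrices with one more column into counting pairs of a matrix and a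
  column, for \<open>rank_count_Suc\<close>.\<close>

lemma bij_betw_add_col:
  "bij_betw (\<lambda>(A, v). add_col A v) (carrier_mat a n \<times> carrier_vec a) (carrier_mat a (Suc n))"
proof (rule bij_betwI[where g = "\<lambda>A. (del_col A, col A n)"])
  fix x :: "'a mat \<times> 'a vec" assume "x \<in> carrier_mat a n \<times> carrier_vec a"
  then show "(del_col (case x of (A, v) \<Rightarrow> add_col A v), col (case x of (A, v) \<Rightarrow> add_col A v) n) = x"
    by (auto simp: add_col_def del_col_def intro!: eq_matI eq_vecI)
qed (auto simp: add_col_carrier del_col_carrier add_col_del_col)

lemma add_col_mult_vec:
  fixes A :: "'a::field mat"
  assumes "A \<in> carrier_mat a n" "v \<in> carrier_vec a" "x \<in> carrier_vec (Suc n)"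
  shows "add_col A v *\<^sub>v x = A *\<^sub>v vec n (($) x) + x $ n \<cdot>\<^sub>v v"
  using assms by (intro eq_vecI) (auto simp: add_col_def scalar_prod_def mult.commute intro!: sum.cong)

text \<open>The last coordinate of the argument becomes the coefficient of \<open>v\<close>.
  Parametrising by pairs lets \<open>rank_add_col_notin\<close> count the image through
  injectivity.\<close>

lemma mat_range_add_col:
  fixes A :: "'a::field mat"
  assumes A: "A \<in> carrier_mat a n" and v: "v \<in> carrier_vec a"
  shows "mat_range (add_col A v) = (\<lambda>(w, c). w + c \<cdot>\<^sub>v v) ` (mat_range A \<times> UNIV)"
proof (intro equalityI subsetI)
  fix y assume "y \<in> mat_range (add_col A v)"
  then obtain x where x: "x \<in> carrier_vec (Suc n)" "y = add_col A v *\<^sub>v x"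
    using A by (auto simp: mat_range_def add_col_def)
  then have "y = A *\<^sub>v vec n (($) x) + x $ n \<cdot>\<^sub>v v" using add_col_mult_vec[OF A v] by simp
  then show "y \<in> (\<lambda>(w, c). w + c \<cdot>\<^sub>v v) ` (mat_range A \<times> UNIV)"
    using A by (auto simp: mat_range_def intro!: image_eqI[where x = "(A *\<^sub>v vec n (($) x), x $ n)"])
next
  fix y assume "y \<in> (\<lambda>(w, c). w + c \<cdot>\<^sub>v v) ` (mat_range A \<times> UNIV)"
  then obtain x c where x: "x \<in> carrier_vec n" and y: "y = A *\<^sub>v x + c \<cdot>\<^sub>v v"
    using A by (auto simp: mat_range_def)
  define z where "z = vec (Suc n) (\<lambda>i. if i < n then x $ i else c)"
  have "vec n (($) z) = x" "z $ n = c" "z \<in> carrier_vec (Suc n)"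
    using x by (auto simp: z_def intro!: eq_vecI)
  then have "y = add_col A v *\<^sub>v z" using add_col_mult_vec[OF A v, of z] y by simp
  then show "y \<in> mat_range (add_col A v)"
    using A \<open>z \<in> _\<close> by (auto simp: mat_range_def add_col_def)
qed

lemma mat_range_carrier: "A \<in> carrier_mat a n \<Longrightarrow> w \<in> mat_range A \<Longrightarrow> w \<in> carrier_vec a"
  by (auto simp: mat_range_def)

lemma mat_range_lincomb:
  fixes A :: "'a::field mat"
  assumes A: "A \<in> carrier_mat a n" and w: "w \<in> mat_range A" "w' \<in> mat_range A"
  shows "w + c \<cdot>\<^sub>v w' \<in> mat_range A"
proof -
  obtain x x' where x: "x \<in> carrier_vec n" "w = A *\<^sub>v x" "x' \<in> carrier_vec n" "w' = A *\<^sub>v x'"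
    using w A by (auto simp: mat_range_def)
  then have "w + c \<cdot>\<^sub>v w' = A *\<^sub>v (x + c \<cdot>\<^sub>v x')"
    using A by (simp add: mult_add_distrib_mat_vec mult_mat_vec)
  then show ?thesis using A x by (auto simp: mat_range_def)
qed

lemma rank_add_col_in:
  fixes A :: "'f::{field,finite} mat"
  assumes A: "A \<in> carrier_mat a n" and v: "v \<in> mat_range A"
  shows "vec_space.rank a (add_col A v) = vec_space.rank a A"
proof -
  have vc: "v \<in> carrier_vec a" using mat_range_carrier[OF A v] .
  have "mat_range (add_col A v) = mat_range A"
  proof
    show "mat_range (add_col A v) \<subseteq> mat_range A"
      unfolding mat_range_add_col[OF A vc] using mat_range_lincomb[OF A _ v] by auto
    show "mat_range A \<subseteq> mat_range (add_col A v)"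
      unfolding mat_range_add_col[OF A vc]
    proof
      fix w assume w: "w \<in> mat_range A"
      then show "w \<in> (\<lambda>(w, c). w + c \<cdot>\<^sub>v v) ` (mat_range A \<times> UNIV)"
        using mat_range_carrier[OF A w] vc by (intro image_eqI[where x = "(w, 0)"]) auto
    qed
  qed
  then have "CARD('f) ^ vec_space.rank a (add_col A v) = CARD('f) ^ vec_space.rank a A"
    using card_mat_range[OF A] card_mat_range[OF add_col_carrier[OF A]] by metis
  then show ?thesis using CARD_field_ge_2[where 'f = 'f] by (simp add: power_inject_exp)
qed

text \<open>If two pairs gave the same vector with different coefficients of \<open>v\<close>, the
  equation could be solved for \<open>v\<close> inside the image. So the pairs are mapped
  injectively and the image grows by the factor q.\<close>

lemma rank_add_col_notin:
  fixes A :: "'f::{field,finite} mat"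
  assumes A: "A \<in> carrier_mat a n" and v: "v \<in> carrier_vec a" "v \<notin> mat_range A"
  shows "vec_space.rank a (add_col A v) = Suc (vec_space.rank a A)"
proof -
  have "inj_on (\<lambda>(w, c). w + c \<cdot>\<^sub>v v) (mat_range A \<times> UNIV)"
  proof (rule inj_onI, clarify)
    fix w w' c c' assume w: "w \<in> mat_range A" "w' \<in> mat_range A"
      and e: "w + c \<cdot>\<^sub>v v = w' + c' \<cdot>\<^sub>v v"
    have wc: "w \<in> carrier_vec a" "w' \<in> carrier_vec a" using w mat_range_carrier[OF A] by auto
    have ei: "w $ i + c * v $ i = w' $ i + c' * v $ i" if "i < a" for i
      using arg_cong[OF e, of "\<lambda>y. y $ i"] that wc v by auto
    have "c = c'"
    proof (rule ccontr)
      assume ne: "c \<noteq> c'"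
      have z: "0\<^sub>v a \<in> mat_range A"
        using A by (auto simp: mat_range_def intro!: image_eqI[where x = "0\<^sub>v n"])
      \<comment> \<open>The zero vector only brings the solution into the shape that
        \<open>mat_range_lincomb\<close> covers.\<close>
      have "v = 0\<^sub>v a + inverse (c - c') \<cdot>\<^sub>v (w' + (-1) \<cdot>\<^sub>v w)"
      proof (rule eq_vecI)
        fix i assume "i < dim_vec (0\<^sub>v a + inverse (c - c') \<cdot>\<^sub>v (w' + (-1) \<cdot>\<^sub>v w))"
        then have i: "i < a" using wc by simp
        have "(c - c') * v $ i = w' $ i - w $ i" using ei[OF i] by (simp add: algebra_simps)
        then have "v $ i = inverse (c - c') * (w' $ i - w $ i)" using ne by (simp add: field_simps)
        then show "v $ i = (0\<^sub>v a + inverse (c - c') \<cdot>\<^sub>v (w' + (-1) \<cdot>\<^sub>v w)) $ i"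
          using i wc by simp
      qed (use v wc in auto)
      then have "v \<in> mat_range A"
        using mat_range_lincomb[OF A z mat_range_lincomb[OF A w(2,1)]] by metis
      then show False using v by simp
    qed
    moreover have "w = w'" using ei wc \<open>c = c'\<close> by (intro eq_vecI) auto
    ultimately show "w = w' \<and> c = c'" by simp
  qed
  then have "card (mat_range (add_col A v)) = card (mat_range A) * CARD('f)"
    unfolding mat_range_add_col[OF A v(1)] by (subst card_image) (auto simp: card_cartesian_product)
  then have "CARD('f) ^ vec_space.rank a (add_col A v) = CARD('f) ^ Suc (vec_space.rank a A)"
    using card_mat_range[OF A] card_mat_range[OF add_col_carrier[OF A]] by (metis power_Suc2)
  then show ?thesis
    using CARD_field_ge_2[where 'f = 'f] by (subst (asm) power_inject_exp) auto
qed

lemma rank_add_col_bounds: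
  fixes A :: "'f::{field,finite} mat"
  assumes "A \<in> carrier_mat a n" "v \<in> carrier_vec a"
  shows "vec_space.rank a A \<le> vec_space.rank a (add_col A v)"
    and "vec_space.rank a (add_col A v) \<le> Suc (vec_space.rank a A)"
  using rank_add_col_in[OF assms(1), of v] rank_add_col_notin[OF assms]
  by (cases "v \<in> mat_range A"; simp)+

lemma rank_del_col_bounds:
  fixes A :: "'f::{field,finite} mat"
  assumes A: "A \<in> carrier_mat a (Suc n)"
  shows "vec_space.rank a (del_col A) \<le> vec_space.rank a A"
    and "vec_space.rank a A \<le> Suc (vec_space.rank a (del_col A))"
  using rank_add_col_bounds[OF del_col_carrier[OF A], of "col A n"] A add_col_del_col[OF A] by auto

text \<open>Deleting the last row projects the image onto its first \<open>a\<close> coordinates. A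
  projection cannot enlarge it, and it merges at most q vectors, which differ in the dropped
  coordinate.\<close>

lemma rank_del_row_bounds:
  fixes A :: "'f::{field,finite} mat"
  assumes A: "A \<in> carrier_mat (Suc a) n"
  shows "vec_space.rank a (del_row A) \<le> vec_space.rank (Suc a) A"
    and "vec_space.rank (Suc a) A \<le> Suc (vec_space.rank a (del_row A))"
proof -
  let ?\<pi> = "\<lambda>w :: 'f vec. vec a (($) w)"
  have mult: "del_row A *\<^sub>v x = ?\<pi> (A *\<^sub>v x)" if "x \<in> carrier_vec n" for x
    using A that by (intro eq_vecI) (auto simp: del_row_def scalar_prod_def)
  have img: "mat_range (del_row A) = ?\<pi> ` mat_range A"
    using A by (auto simp: mat_range_def del_row_def image_image simp flip: mult)
  then have "card (mat_range (del_row A)) \<le> card (mat_range A)"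
    by (simp add: card_image_le finite_mat_range)
  then show "vec_space.rank a (del_row A) \<le> vec_space.rank (Suc a) A"
    using rank_le_of_card_mat_range[OF del_row_carrier[OF A] A, of 0] by simp
  have "inj_on (\<lambda>w. (w $ a, ?\<pi> w)) (mat_range A)"
  proof (rule inj_onI)
    fix w w' assume w: "w \<in> mat_range A" "w' \<in> mat_range A" and e: "(w $ a, ?\<pi> w) = (w' $ a, ?\<pi> w')"
    have "w $ i = w' $ i" if "i < Suc a" for i
    proof (cases "i = a")
      case False
      then have "?\<pi> w $ i = ?\<pi> w' $ i" using e by (metis prod.inject)
      then show ?thesis using that False by simp
    qed (use e in simp)
    then show "w = w'"
      using mat_range_carrier[OF A w(1)] mat_range_carrier[OF A w(2)] by (intro eq_vecI) auto
  qed
  moreover have "(\<lambda>w. (w $ a, ?\<pi> w)) ` mat_range A \<subseteq> UNIV \<times> mat_range (del_row A)"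
    unfolding img by auto
  ultimately have "card (mat_range A) \<le> card ((UNIV :: 'f set) \<times> mat_range (del_row A))"
    by (intro card_inj_on_le) (auto simp: finite_mat_range)
  then show "vec_space.rank (Suc a) A \<le> Suc (vec_space.rank a (del_row A))"
    using rank_le_of_card_mat_range[OF A del_row_carrier[OF A], of 1]
    by (simp add: card_cartesian_product)
qed

section \<open>Falling q-products and Gaussian binomials\<close>

text \<open>For a prime power q, the number of ordered linearly independent \<open>k\<close>-tuples
  in the \<open>n\<close>-dimensional space over the field with q elements.\<close>

definition falling_q :: "nat \<Rightarrow> nat \<Rightarrow> nat \<Rightarrow> real" where
  "falling_q q n k = (\<Prod>i<k. real q ^ n - real q ^ i)"

lemma falling_q_Suc: "falling_q q n (Suc k) = falling_q q n k * (real q ^ n - real q ^ k)"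
  by (simp add: falling_q_def)

text \<open>Splits off the first factor and takes q out of each other one, whereas
  \<open>falling_q_Suc\<close> splits off the last factor.\<close>

lemma falling_q_Suc_Suc:
  "falling_q q (Suc n) (Suc k) = (real q ^ Suc n - 1) * real q ^ k * falling_q q n k"
proof -
  have "falling_q q (Suc n) (Suc k) = (real q ^ Suc n - 1) * (\<Prod>i<k. real q * (real q ^ n - real q ^ i))"
    unfolding falling_q_def prod.lessThan_Suc_shift by (simp add: algebra_simps)
  then show ?thesis by (simp add: falling_q_def prod.distrib)
qed

text \<open>The factor at \<open>i = n\<close> vanishes. This later cuts the sum over ranks off at
  the smaller dimension.\<close>

lemma falling_q_eq_0: "n < k \<Longrightarrow> falling_q q n k = 0"
  unfolding falling_q_def by (rule prod_zero) auto

lemma falling_q_self_neq_0: "2 \<le> q \<Longrightarrow> falling_q q k k \<noteq> 0"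
  unfolding falling_q_def by (auto simp: power_inject_exp)

lemma q_binomial_eq_falling_q: "q_binomial q n k = falling_q q n k / falling_q q k k"
  by (simp add: q_binomial_def falling_q_def prod_dividef)

text \<open>The q-Pascal rule: over the common denominator
  \<open>falling_q q (Suc k) (Suc k)\<close>, all numerators are multiples of
  \<open>falling_q q n k\<close>.\<close>

lemma q_binomial_Suc_Suc:
  assumes q: "2 \<le> q"
  shows "q_binomial q (Suc n) (Suc k) = real q ^ Suc k * q_binomial q n (Suc k) + q_binomial q n k"
proof -
  have "1 < real q ^ Suc k" using q by (intro one_less_power) auto
  then have nz: "real q ^ Suc k - 1 \<noteq> 0" "real q ^ k \<noteq> 0" "falling_q q k k \<noteq> 0"
    using q falling_q_self_neq_0[OF q] by auto
  \<comment> \<open>By \<open>falling_q_Suc_Suc\<close>, the factor that leads from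
    \<open>falling_q q k k\<close> to the common denominator.\<close>
  let ?D = "(real q ^ Suc k - 1) * real q ^ k"
  have "(real q ^ Suc n - 1) * real q ^ k * falling_q q n k
      = real q ^ Suc k * (falling_q q n k * (real q ^ n - real q ^ k)) + falling_q q n k * ?D"
    by (simp add: algebra_simps)
  moreover have "falling_q q n k / falling_q q k k = falling_q q n k * ?D / (?D * falling_q q k k)"
    using nz by simp
  ultimately show ?thesis
    unfolding q_binomial_eq_falling_q falling_q_Suc_Suc falling_q_Suc[of q n]
    by (simp only: add_divide_distrib times_divide_eq_right)
qed

text \<open>For a prime power q both sides are the order of the general linear group of degree
  \<open>r\<close>. In the induction the binomial exponent grows by \<open>r\<close>, and
  \<open>q - 1\<close> times the new q-integer is \<open>q ^ Suc r - 1\<close>.\<close>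

lemma falling_q_self_eq:
  assumes q: "2 \<le> q"
  shows "real q ^ (r choose 2) * (real q - 1) ^ r * q_fact q r = falling_q q r r"
proof (induction r)
  case 0
  then show ?case by (simp add: q_fact_def falling_q_def binomial_eq_0)
next
  case (Suc r)
  have "Suc r choose 2 = r + (r choose 2)" by (simp add: numeral_2_eq_2)
  moreover have "(real q - 1) * q_int q (Suc r) = real q ^ Suc r - 1"
    using q by (simp add: q_int_def)
  moreover have "q_fact q (Suc r) = q_fact q r * q_int q (Suc r)" by (simp add: q_fact_def)
  ultimately have "real q ^ (Suc r choose 2) * (real q - 1) ^ Suc r * q_fact q (Suc r)
      = (real q ^ Suc r - 1) * real q ^ r * (real q ^ (r choose 2) * (real q - 1) ^ r * q_fact q r)"
    by (simp add: power_add mult_ac)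
  then show ?case by (simp only: Suc falling_q_Suc_Suc)
qed

section \<open>Counting matrices of given rank\<close>

definition rank_count :: "'f::{field,finite} itself \<Rightarrow> nat \<Rightarrow> nat \<Rightarrow> nat \<Rightarrow> nat" where
  "rank_count F a n r = card {A \<in> carrier_mat a n. vec_space.rank a (A :: 'f mat) = r}"

lemma rank_count_0: "rank_count (F :: 'f::{field,finite} itself) a 0 r = (if r = 0 then 1 else 0)"
proof -
  have "vec_space.rank a A = 0" if "A \<in> carrier_mat a 0" for A :: "'f mat"
    using vec_space.rank_le_nc[OF that] by simp
  moreover have "carrier_mat a 0 = {0\<^sub>m a 0 :: 'f mat}" by (auto intro!: eq_matI)
  ultimately have "{A \<in> carrier_mat a 0. vec_space.rank a (A :: 'f mat) = r}
      = (if r = 0 then {0\<^sub>m a 0} else {})" by auto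
  then show ?thesis by (simp add: rank_count_def)
qed

text \<open>Columns in the image keep the rank and all others raise it by one. The second case
  forces \<open>r\<close> to be positive, so \<open>r - 1\<close> is then the rank of
  \<open>A\<close>.\<close>

lemma card_add_col_rank_eq:
  fixes A :: "'f::{field,finite} mat"
  assumes A: "A \<in> carrier_mat a n"
  shows "real (card {v \<in> carrier_vec a. vec_space.rank a (add_col A v) = r}) =
    (if vec_space.rank a A = r then real CARD('f) ^ r
     else if Suc (vec_space.rank a A) = r then real CARD('f) ^ a - real CARD('f) ^ (r - 1) else 0)"
proof -
  let ?k = "vec_space.rank a A"
  have sub: "mat_range A \<subseteq> carrier_vec a" using mat_range_carrier[OF A] by auto
  have "{v \<in> carrier_vec a. vec_space.rank a (add_col A v) = r} =
      (if ?k = r then mat_range A else if Suc ?k = r then carrier_vec a - mat_range A else {})"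
  proof (rule Set.set_eqI)
    fix v
    show "v \<in> {v \<in> carrier_vec a. vec_space.rank a (add_col A v) = r} \<longleftrightarrow>
      v \<in> (if ?k = r then mat_range A else if Suc ?k = r then carrier_vec a - mat_range A else {})"
      using rank_add_col_in[OF A, of v] rank_add_col_notin[OF A, of v] sub
      by (cases "v \<in> mat_range A") auto
  qed
  moreover have "card (mat_range A) \<le> card (carrier_vec a :: 'f vec set)"
    using sub by (simp add: card_mono)
  ultimately show ?thesis
    using sub by (auto simp: card_Diff_subset finite_mat_range of_nat_diff card_mat_range[OF A] card_carrier_vec)
qed

lemma rank_count_Suc:
  "real (rank_count (F :: 'f::{field,finite} itself) a (Suc n) r) =
    real CARD('f) ^ r * rank_count F a n r
    + (if r = 0 then 0 else (real CARD('f) ^ a - real CARD('f) ^ (r - 1)) * rank_count F a n (r - 1))"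
proof -
  let ?M = "carrier_mat a n :: 'f mat set" and ?q = "real CARD('f)"
  let ?rk = "vec_space.rank a :: 'f mat \<Rightarrow> nat"
  let ?V = "\<lambda>A. {v \<in> carrier_vec a. ?rk (add_col A v) = r}"
  have fin: "finite ?M" by (rule finite_carrier_mat)
  have "bij_betw (\<lambda>(A, v). add_col A v) (SIGMA A:?M. ?V A)
      {A \<in> carrier_mat a (Suc n). ?rk A = r}"
  proof (rule bij_betw_subset[OF bij_betw_add_col[of a n]])
    show "(\<lambda>(A, v). add_col A v) ` (SIGMA A:?M. ?V A) = {A \<in> carrier_mat a (Suc n). ?rk A = r}"
      unfolding bij_betw_imp_surj_on[OF bij_betw_add_col[of a n, where 'a = 'f], symmetric] by auto
  qed auto
  then have "rank_count F a (Suc n) r = card (SIGMA A:?M. ?V A)"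
    unfolding rank_count_def by (rule bij_betw_same_card[symmetric])
  also have "\<dots> = (\<Sum>A\<in>?M. card (?V A))"
    by (rule card_SigmaI) (auto simp: fin)
  finally have "real (rank_count F a (Suc n) r) = (\<Sum>A\<in>?M. real (card (?V A)))" by simp
  \<comment> \<open>The two rank conditions exclude each other, so the nested conditional becomes a
    sum that can be split.\<close>
  also have "\<dots> = (\<Sum>A\<in>?M. (if ?rk A = r then ?q ^ r else 0)
      + (if Suc (?rk A) = r then ?q ^ a - ?q ^ (r - 1) else 0))"
    by (intro sum.cong refl) (simp add: card_add_col_rank_eq)
  also have "\<dots> = (\<Sum>A\<in>?M. if ?rk A = r then ?q ^ r else 0)
      + (\<Sum>A\<in>?M. if Suc (?rk A) = r then ?q ^ a - ?q ^ (r - 1) else 0)"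
    by (rule sum.distrib)
  also have "(\<Sum>A\<in>?M. if ?rk A = r then ?q ^ r else 0) = ?q ^ r * rank_count F a n r"
    using fin by (simp add: sum.If_cases rank_count_def Int_def)
  also have "(\<Sum>A\<in>?M. if Suc (?rk A) = r then ?q ^ a - ?q ^ (r - 1) else 0)
      = (if r = 0 then 0 else (?q ^ a - ?q ^ (r - 1)) * rank_count F a n (r - 1))"
    using fin by (cases r) (simp_all add: sum.If_cases rank_count_def Int_def)
  finally show ?thesis .
qed

text \<open>In the recursion for \<open>r = Suc k\<close>, the factor \<open>q ^ a - q ^ k\<close>
  completes \<open>falling_q\<close> by \<open>falling_q_Suc\<close>; what remains is the q-Pascal
  rule. The induction leaves \<open>r\<close> free because the recursion also uses
  \<open>r - 1\<close>.\<close>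

lemma rank_count_eq:
  "real (rank_count (F :: 'f::{field,finite} itself) a n r) =
    falling_q CARD('f) a r * q_binomial CARD('f) n r"
proof (induction n arbitrary: r)
  case 0
  then show ?case
    by (cases r) (simp_all add: rank_count_0 q_binomial_eq_falling_q falling_q_eq_0, simp add: falling_q_def)
next
  case (Suc n)
  show ?case
  proof (cases r)
    case 0
    then show ?thesis using Suc[of 0] by (simp add: rank_count_Suc q_binomial_def)
  next
    case (Suc k)
    then show ?thesis
      using Suc.IH q_binomial_Suc_Suc[OF CARD_field_ge_2[where 'f = 'f]]
      by (simp add: rank_count_Suc falling_q_Suc algebra_simps)
  qed
qed

section \<open>Puncturing codes\<close>

text \<open>Common core of row and column deletion. Images of distinct codewords keep distance at
  least \<open>d\<close>; as this is positive they cannot coincide, and the code keeps its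
  size.\<close>

lemma Lambda_Suc_le:
  fixes F :: "'f::{field,finite} itself" and f :: "'f mat \<Rightarrow> 'f mat"
  assumes d: "1 \<le> d"
    and carrier: "\<And>X. X \<in> carrier_mat a b \<Longrightarrow> f X \<in> carrier_mat a' b'"
    and diff: "\<And>X Y. X \<in> carrier_mat a b \<Longrightarrow> Y \<in> carrier_mat a b \<Longrightarrow> f (X - Y) = f X - f Y"
    and rank_le: "\<And>X. X \<in> carrier_mat a b \<Longrightarrow> vec_space.rank a' (f X) \<le> vec_space.rank a X"
    and le_rank: "\<And>X. X \<in> carrier_mat a b \<Longrightarrow> vec_space.rank a X \<le> Suc (vec_space.rank a' (f X))"
  shows "Lambda F a b (Suc d) u \<le> Lambda F a' b' d u"
proof -
  obtain C where C: "C \<in> rank_codes F a b (Suc d) u" "card C = Lambda F a b (Suc d) u"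
    using Lambda_attained by blast
  have dist: "d \<le> vec_space.rank a' (f X - f Y)" if "X \<in> C" "Y \<in> C" "X \<noteq> Y" for X Y
  proof -
    have c: "X \<in> carrier_mat a b" "Y \<in> carrier_mat a b" and "Suc d \<le> vec_space.rank a (X - Y)"
      using that C(1) by (auto simp: rank_codes_def)
    then show ?thesis using le_rank[of "X - Y"] diff[OF c] by (simp add: minus_carrier_mat)
  qed
  have "inj_on f C"
  proof (rule inj_onI, rule ccontr)
    fix X Y assume XY: "X \<in> C" "Y \<in> C" "f X = f Y" "X \<noteq> Y"
    then have "f Y \<in> carrier_mat a' b'" using carrier C(1) by (auto simp: rank_codes_def)
    then have "f X - f Y = 0\<^sub>m a' b'" using XY by auto
    then show False using dist[OF XY(1,2,4)] d by (simp add: rank_zero_mat)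
  qed
  moreover have "vec_space.rank a' (f X) \<le> u" if "X \<in> C" for X
    using that C(1) order_trans[OF rank_le] by (auto simp: rank_codes_def)
  then have "f ` C \<in> rank_codes F a' b' d u"
    using C(1) carrier dist by (auto simp: rank_codes_def)
  ultimately show ?thesis
    using card_le_Lambda card_image C(2) by metis
qed

lemma Lambda_del_col:
  assumes "1 \<le> d"
  shows "Lambda F a (Suc b) (Suc d) u \<le> Lambda F a b d u"
proof (rule Lambda_Suc_le[OF assms, where f = del_col])
  fix X Y :: "'a mat" assume "X \<in> carrier_mat a (Suc b)" "Y \<in> carrier_mat a (Suc b)"
  then show "del_col (X - Y) = del_col X - del_col Y"
    by (intro eq_matI) (auto simp: del_col_def)
qed (auto simp: del_col_carrier rank_del_col_bounds)

lemma Lambda_del_row: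
  assumes "1 \<le> d"
  shows "Lambda F (Suc a) b (Suc d) u \<le> Lambda F a b d u"
proof (rule Lambda_Suc_le[OF assms, where f = del_row])
  fix X Y :: "'a mat" assume "X \<in> carrier_mat (Suc a) b" "Y \<in> carrier_mat (Suc a) b"
  then show "del_row (X - Y) = del_row X - del_row Y"
    by (intro eq_matI) (auto simp: del_row_def)
qed (auto simp: del_row_carrier rank_del_row_bounds)

text \<open>Each deletion costs one unit of distance. Distance 1 is where this stops: there
  distinctness alone guarantees the distance and only the rank bound restricts the code.\<close>

lemma Lambda_del_cols: "Lambda F a (b + k) (Suc k) u \<le> Lambda F a b 1 u"
proof (induction k)
  case (Suc k)
  then show ?case using Lambda_del_col[of "Suc k" F a "b + k" u] by simp
qed simp

lemma Lambda_del_rows: "Lambda F (a + k) b (Suc k) u \<le> Lambda F a b 1 u"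
proof (induction k)
  case (Suc k)
  then show ?case using Lambda_del_row[of "Suc k" F "a + k" b u] by simp
qed simp

section \<open>Bounding codes by rank counts\<close>

lemma Lambda_le_sum_rank_count:
  "Lambda (F :: 'f::{field,finite} itself) a b d u \<le> (\<Sum>r = 0..u. rank_count F a b r)"
proof -
  let ?S = "\<lambda>r. {A \<in> carrier_mat a b. vec_space.rank a (A :: 'f mat) = r}"
  obtain C where C: "C \<in> rank_codes F a b d u" "card C = Lambda F a b d u"
    using Lambda_attained by blast
  have fin: "finite (?S r)" for r
    by (rule finite_subset[OF _ finite_carrier_mat[of a b]]) auto
  have "C \<subseteq> (\<Union>r\<in>{0..u}. ?S r)" using C(1) by (auto simp: rank_codes_def)
  then have "card C \<le> card (\<Union>r\<in>{0..u}. ?S r)" by (intro card_mono) (simp_all add: fin)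
  also have "\<dots> \<le> (\<Sum>r = 0..u. card (?S r))" by (rule card_UN_le) simp
  finally show ?thesis using C(2) by (simp add: rank_count_def)
qed

text \<open>Writing \<open>falling_q q a r\<close> as \<open>falling_q q r r\<close> times a
  Gaussian binomial makes the count symmetric in \<open>a\<close> and \<open>b\<close>, so it serves
  whichever side is shorter.\<close>

lemma Lambda_le_sum:
  fixes F :: "'f::{field,finite} itself"
  defines "q \<equiv> CARD('f)"
  shows "real (Lambda F a b d u) \<le> (\<Sum>r = 0..min u (min a b).
    real q ^ (r choose 2) * (real q - 1) ^ r * q_fact q r * q_binomial q a r * q_binomial q b r)"
proof -
  let ?t = "\<lambda>r. real q ^ (r choose 2) * (real q - 1) ^ r * q_fact q r * q_binomial q a r * q_binomial q b r"
  have q: "2 \<le> q" unfolding q_def by (rule CARD_field_ge_2)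
  have t: "real (rank_count F a b r) = ?t r" for r
    unfolding rank_count_eq falling_q_self_eq[OF q] q_def[symmetric]
    using falling_q_self_neq_0[OF q] by (simp add: q_binomial_eq_falling_q[of q a])
  have "real (Lambda F a b d u) \<le> (\<Sum>r = 0..u. ?t r)"
    using Lambda_le_sum_rank_count[of F a b d u] unfolding t[symmetric]
    by (simp flip: of_nat_sum)
  \<comment> \<open>For \<open>r\<close> above \<open>min a b\<close>, one of the two Gaussian
    binomials vanishes.\<close>
  also have "\<dots> = (\<Sum>r = 0..min u (min a b). ?t r)"
    by (rule sum.mono_neutral_right) (auto simp: q_binomial_eq_falling_q falling_q_eq_0)
  finally show ?thesis .
qed

theorem theorem9:
  fixes q a b d u :: nat
  assumes "primepow q" and "CARD('f::{field,finite}) = q"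
    and "2 \<le> d" and "d \<le> min a b"
  shows "Lambda TYPE('f) a b d u \<le> Lambda TYPE('f) a (b - 1) (d - 1) u
    \<and> real (Lambda TYPE('f) a b d u) \<le>
      (\<Sum>r = 0..min u (min a b - d + 1).
        real q ^ (r choose 2) * (real q - 1) ^ r * q_fact q r
        * q_binomial q (min a b - d + 1) r * q_binomial q (max a b) r)"
proof
  let ?F = "TYPE('f)"
  \<comment> \<open>\<open>k\<close> is the number of rows or columns to delete and \<open>m\<close>
    the length left on the shorter side. As \<open>m\<close> is at most \<open>max a b\<close>, it
    is still the smaller dimension afterwards, which gives the upper limit of the sum.\<close>
  define k where "k = d - 1"
  define m where "m = min a b - d + 1"
  have d: "d = Suc k" "1 \<le> k" and m: "min a b = m + k" and mM: "m \<le> max a b"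
    using assms unfolding k_def m_def by auto
  show "Lambda ?F a b d u \<le> Lambda ?F a (b - 1) (d - 1) u"
    using Lambda_del_col[OF d(2), of ?F a "b - 1" u] assms(4) d by simp
  have "real (Lambda ?F a b d u) \<le> (\<Sum>r = 0..min u m.
    real q ^ (r choose 2) * (real q - 1) ^ r * q_fact q r * q_binomial q m r * q_binomial q (max a b) r)"
  \<comment> \<open>The shorter side is cut down: rows here, columns in the other case.\<close>
  proof (cases "a \<le> b")
    case True
    then have "Lambda ?F a b d u \<le> Lambda ?F m b 1 u"
      using Lambda_del_rows[of ?F m k b u] m d by simp
    then have "real (Lambda ?F a b d u) \<le> real (Lambda ?F m b 1 u)" by simp
    also note Lambda_le_sum[of ?F m b 1 u]
    finally show ?thesis using True mM assms(2) by (simp add: min_absorb1 max_absorb2)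
  next
    case False
    then have "Lambda ?F a b d u \<le> Lambda ?F a m 1 u"
      using Lambda_del_cols[of ?F a m k u] m d by simp
    then have "real (Lambda ?F a b d u) \<le> real (Lambda ?F a m 1 u)" by simp
    also note Lambda_le_sum[of ?F a m 1 u]
    finally show ?thesis using False mM assms(2) by (simp add: min_absorb2 max_absorb1 mult_ac)
  qed
  then show "real (Lambda ?F a b d u) \<le>
      (\<Sum>r = 0..min u (min a b - d + 1).
        real q ^ (r choose 2) * (real q - 1) ^ r * q_fact q r
        * q_binomial q (min a b - d + 1) r * q_binomial q (max a b) r)"
    unfolding m_def .
qed

end
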